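(* Let $A$ be a $C^*$-algebra and let $l_2(A)$ be the standard $A$-$A$-bimodule. The quasi-multipliers of $l_2(A)$ coincide with the set of sequences $(q_i)$, $q_i\in QM(A)$, such that the norms of $\bigoplus_{i=1}^nq_i$ are uniformly bounded over $n$ and $\sum_i(aq_ic)^*(aq_ic)$ converges in norm for any $a,c\in A$. (Here a sequence $(q_i)$ corresponds to the map $(a,c)\mapsto(aq_ic)_i$.)
   Context: $l_2(A)=\{(x_i)_{i\ge1} : x_i\in A,\ \sum_ix_i^*x_i\text{ converges in norm}\}$ with norm $\|(x_i)\|=\|\sum_ix_i^*x_i\|^{1/2}$ and entry-wise left and right multiplication by $A$; $A^n$ is normed by $\|(x_1,\dots,x_n)\|=\|\sum_{i=1}^nx_i^*x_i\|^{1/2}$. For $U=A$, $A^n$ or $l_2(A)$, the quasi-multipliers $QM(U)$ are the bounded bilinear maps $q\colon A\times A\to U$ with $q(ca,bd)=c\,q(a,b)\,d$ for $a,b,c,d\in A$, with norm $\|q\|=\sup\{\|q(a,b)\| : \|a\|\le1,\|b\|\le1\}$. For $q\in QM(A)$ one writes $aqc:=q(a,c)$. $\bigoplus_{i=1}^nq_i$ denotes the quasi-multiplier $A\times A\to A^n$, $(a,c)\mapsto(aq_1c,\dots,aq_nc)$. *)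

theory Defs
  imports Complex_Main
begin

text \<open>Complex \<open>C\<^sup>*\<close>-algebras, not assumed unital (and possibly zero).\<close>

class cstar_algebra = real_normed_algebra + banach +
  fixes scaleC :: "complex \<Rightarrow> 'a \<Rightarrow> 'a"
    and star :: "'a \<Rightarrow> 'a"
  assumes scaleC_add_right: "scaleC z (x + y) = scaleC z x + scaleC z y"
    and scaleC_add_left: "scaleC (z + w) x = scaleC z x + scaleC w x"
    and scaleC_scaleC: "scaleC z (scaleC w x) = scaleC (z * w) x"
    and scaleR_scaleC: "scaleR r x = scaleC (complex_of_real r) x"
    and norm_scaleC: "norm (scaleC z x) = cmod z * norm x"
    and mult_scaleC_left: "scaleC z x * y = scaleC z (x * y)"
    and mult_scaleC_right: "x * scaleC z y = scaleC z (x * y)"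
    and star_star: "star (star x) = x"
    and star_add: "star (x + y) = star x + star y"
    and star_scaleC: "star (scaleC z x) = scaleC (cnj z) (star x)"
    and star_mult: "star (x * y) = star y * star x"
    and cstar_identity: "norm (star x * x) = (norm x)\<^sup>2"

text \<open>
  The data of a normed \<open>A\<close>-\<open>A\<close>-bimodule with an explicit carrier. The record imposes no
  axioms; it only allows quasi-multipliers to be defined once for the three bimodules
  \<open>A\<close>, \<open>A\<^sup>n\<close> (with \<open>n\<close> a variable) and \<open>l\<^sub>2(A)\<close>.
\<close>

record ('a, 'u) bimodule =
  elems :: "'u set"
  add :: "'u \<Rightarrow> 'u \<Rightarrow> 'u"
  scale :: "complex \<Rightarrow> 'u \<Rightarrow> 'u"
  lmul :: "'a \<Rightarrow> 'u \<Rightarrow> 'u"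
  rmul :: "'u \<Rightarrow> 'a \<Rightarrow> 'u"
  bnorm :: "'u \<Rightarrow> real"

definition alg_bimodule :: "('a::cstar_algebra, 'a) bimodule" where
  "alg_bimodule =
    \<lparr>elems = UNIV, add = (+), scale = scaleC, lmul = (*), rmul = (*), bnorm = norm\<rparr>"

text \<open>
  Sequences are indexed from \<open>0\<close>, and an \<open>n\<close>-tuple is a sequence vanishing at all
  indices \<open>i \<ge> n\<close>.
\<close>

definition pow_bimodule :: "nat \<Rightarrow> ('a::cstar_algebra, nat \<Rightarrow> 'a) bimodule" where
  "pow_bimodule n =
    \<lparr>elems = {x. \<forall>i\<ge>n. x i = 0},
     add = (\<lambda>x y i. x i + y i),
     scale = (\<lambda>z x i. scaleC z (x i)),
     lmul = (\<lambda>a x i. a * x i),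
     rmul = (\<lambda>x a i. x i * a),
     bnorm = (\<lambda>x. sqrt (norm (\<Sum>i<n. star (x i) * x i)))\<rparr>"

definition l2_bimodule :: "('a::cstar_algebra, nat \<Rightarrow> 'a) bimodule" where
  "l2_bimodule =
    \<lparr>elems = {x. summable (\<lambda>i. star (x i) * x i)},
     add = (\<lambda>x y i. x i + y i),
     scale = (\<lambda>z x i. scaleC z (x i)),
     lmul = (\<lambda>a x i. a * x i),
     rmul = (\<lambda>x a i. x i * a),
     bnorm = (\<lambda>x. sqrt (norm (\<Sum>i. star (x i) * x i)))\<rparr>"

definition QM :: "('a::cstar_algebra, 'u) bimodule \<Rightarrow> ('a \<Rightarrow> 'a \<Rightarrow> 'u) set" where
  "QM U = {q.
     (\<forall>a b. q a b \<in> elems U) \<and>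
     (\<forall>a a' b. q (a + a') b = add U (q a b) (q a' b)) \<and>
     (\<forall>a b b'. q a (b + b') = add U (q a b) (q a b')) \<and>
     (\<forall>z a b. q (scaleC z a) b = scale U z (q a b)) \<and>
     (\<forall>z a b. q a (scaleC z b) = scale U z (q a b)) \<and>
     (\<exists>K. \<forall>a b. bnorm U (q a b) \<le> K * norm a * norm b) \<and>
     (\<forall>a b c d. q (c * a) (b * d) = rmul U (lmul U c (q a b)) d)}"

definition qm_norm :: "('a::cstar_algebra, 'u) bimodule \<Rightarrow> ('a \<Rightarrow> 'a \<Rightarrow> 'u) \<Rightarrow> real" where
  "qm_norm U q = Sup {bnorm U (q a b) | a b. norm a \<le> 1 \<and> norm b \<le> 1}"

definition qm_dsum :: "nat \<Rightarrow> (nat \<Rightarrow> 'a \<Rightarrow> 'a \<Rightarrow> 'a) \<Rightarrow> 'a \<Rightarrow> 'a \<Rightarrow> nat \<Rightarrow> 'a::cstar_algebra" where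
  "qm_dsum n q a c = (\<lambda>i. if i < n then q i a c else 0)"

definition qm_of_seq :: "(nat \<Rightarrow> 'a \<Rightarrow> 'a \<Rightarrow> 'a) \<Rightarrow> 'a \<Rightarrow> 'a \<Rightarrow> nat \<Rightarrow> 'a::cstar_algebra" where
  "qm_of_seq q a c = (\<lambda>i. q i a c)"

end

theory Submission
  imports Defs "HOL-Analysis.Bounded_Linear_Function"
    "HOL-Computational_Algebra.Formal_Power_Series"
begin

text \<open>
  A sequence of quasi-multipliers and the map it induces determine each other componentwise, so the
  content is the comparison of two bounds: a uniform bound on the partial sums
  \<open>\<Sum>i<n. (a q\<^sub>i c)\<^sup>* (a q\<^sub>i c)\<close>, and a bound on the full series.

  A uniform bound on the partial sums passes to the limit, since the norm is continuous and
  the quasi-multipliers are homogeneous in both arguments (\<open>qm_of_seq_QM\<close>).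

  Conversely, a bound on the full series must bound every partial sum and every single component.
  This holds because the terms are positive and the norm of a \<open>C\<^sup>*\<close>-algebra is monotone on positive
  elements (\<open>norm_sum_star_mult_mono\<close>). The bulk of the development proves this directly from the
  \<open>C\<^sup>*\<close>-identity, without spectral theory. The algebra is embedded isometrically in a unital
  \<open>C\<^sup>*\<close>-algebra, its adjointable operators. There, positivity of a self-adjoint \<open>h\<close> means
  \<open>norm (t 1 - h) \<le> t\<close> for some \<open>t \<ge> 0\<close>, and the binomial series supplies square roots of
  positive elements (\<open>positive_sqrt\<close>). For commuting self-adjoint \<open>u\<close> and \<open>v\<close> the factorisation
  \<open>u\<^sup>2 + v\<^sup>2 = (u + \<i> v)\<^sup>* (u + \<i> v)\<close> bounds the norm of \<open>u\<^sup>2\<close>; applied to square roots, this gives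
  monotonicity of the norm (\<open>norm_le_norm_add_positive\<close>). Finally, \<open>x\<^sup>* x\<close> is positive
  (\<open>positive_star_mult_self\<close>) by compressing to its negative part, where the asymmetry between
  \<open>y\<^sup>* y\<close> and \<open>y y\<^sup>*\<close> is contradictory.
\<close>

section \<open>Elementary consequences of the axioms\<close>

lemma norm_star [simp]: "norm (star x) = norm (x::'a::cstar_algebra)"
proof -
  have le: "norm y \<le> norm (star y)" for y :: 'a
  proof (cases "y = 0")
    case False
    have "norm y * norm y \<le> norm (star y) * norm y"
      using norm_mult_ineq[of "star y" y] cstar_identity[of y] by (simp add: power2_eq_square)
    then show ?thesis using False by simp
  qed simp
  show ?thesis using le[of x] le[of "star x"] by (simp add: star_star)
qed

lemma scaleC_real: "scaleC (complex_of_real r) x = r *\<^sub>R (x::'a::cstar_algebra)"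
  by (simp add: scaleR_scaleC)

lemma scaleC_one [simp]: "scaleC 1 x = (x::'a::cstar_algebra)"
  using scaleC_real[of 1 x] by simp

lemma scaleC_minus_one: "scaleC (-1) x = - (x::'a::cstar_algebra)"
  using scaleC_real[of "-1" x] by simp

lemma star_scaleR: "star (r *\<^sub>R x) = r *\<^sub>R star (x::'a::cstar_algebra)"
  by (simp add: scaleR_scaleC star_scaleC)

lemma star_zero [simp]: "star 0 = (0::'a::cstar_algebra)"
  using star_add[of "0::'a" 0] by simp

lemma star_minus: "star (- x) = - star (x::'a::cstar_algebra)"
  using star_scaleR[of "-1" x] by simp

lemma star_diff: "star (x - y) = star x - star (y::'a::cstar_algebra)"
  using star_add[of x "- y"] by (simp add: star_minus)

lemma star_mult_self_eq_0: "star x * x = 0 \<longleftrightarrow> x = (0::'a::cstar_algebra)"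
  using cstar_identity[of x] by auto

lemma bounded_linear_star: "bounded_linear (star :: 'a::cstar_algebra \<Rightarrow> 'a)"
  by (rule bounded_linear_intro[where K = 1]) (auto simp: star_add star_scaleR)

text \<open>
  The algebra acts faithfully on itself by multiplication: a left annihilator \<open>d\<close> of the whole
  algebra annihilates \<open>star d\<close>, and then the \<open>C\<^sup>*\<close>-identity forces \<open>d = 0\<close>. This takes the place of
  multiplying by a unit.
\<close>
lemma multiplication_faithful:
  fixes a b :: "'a::cstar_algebra"
  assumes "\<And>y. a * y = b * y"
  shows "a = b"
proof -
  have "star (star (a - b)) * star (a - b) = 0"
    using assms[of "star (a - b)"] by (simp add: star_star left_diff_distrib)
  then have "star (a - b) = 0"
    using star_mult_self_eq_0 by blast
  then have "star (star (a - b)) = 0" by simp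
  then show ?thesis by (simp add: star_star)
qed

section \<open>Adjointable operators as a unital enlargement\<close>

lift_definition scaleC_blinfun :: "complex \<Rightarrow> 'a::cstar_algebra \<Rightarrow>\<^sub>L 'a" is scaleC
proof -
  fix z
  show "bounded_linear (scaleC z :: 'a \<Rightarrow> 'a)"
    by (rule bounded_linear_intro[where K = "cmod z"])
       (auto simp: scaleC_add_right norm_scaleC scaleR_scaleC scaleC_scaleC mult.commute)
qed

(* The carrier of the new type consists of bounded operators themselves; without this, lifting and
   transfer would descend further, to the underlying functions. *)
lifting_forget blinfun.lifting

lemma adjoint_sym:
  fixes T S :: "'a::cstar_algebra \<Rightarrow> 'a"
  assumes "\<forall>x y. star (T x) * y = star x * S y"
  shows "star (S x) * y = star x * T y"
proof -
  have "star (star (S x) * y) = star (star x * T y)"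
    using assms by (simp add: star_mult star_star)
  then have "star (star (star (S x) * y)) = star (star (star x * T y))" by simp
  then show ?thesis by (simp only: star_star)
qed

text \<open>
  The multiplier algebra of \<open>A\<close>, presented as the adjointable operators of \<open>A\<close> regarded as a Hilbert
  module over itself with inner product \<open>star x * y\<close>. Keeping the adjoint as a second component makes
  the involution a swap and makes the carrier visibly closed, which gives completeness. Formal sums
  \<open>a + \<lambda>1\<close> normed as operators on \<open>A\<close> would not do as a unital enlargement: when \<open>A\<close> already has a
  unit \<open>e\<close>, the element \<open>e - 1\<close> acts as zero.
\<close>
typedef (overloaded) ('a::cstar_algebra) adjointable =
  "{p :: ('a \<Rightarrow>\<^sub>L 'a) \<times> ('a \<Rightarrow>\<^sub>L 'a). \<forall>x y. star (fst p x) * y = star x * snd p y}"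
  by (rule exI[of _ "(0, 0)"]) simp

setup_lifting type_definition_adjointable

lift_definition act :: "'a::cstar_algebra adjointable \<Rightarrow> 'a \<Rightarrow>\<^sub>L 'a" is fst .
lift_definition coact :: "'a::cstar_algebra adjointable \<Rightarrow> 'a \<Rightarrow>\<^sub>L 'a" is snd .

lemma act_adjoint: "star (act T x) * y = star x * coact T y"
  by transfer auto

lemma coact_adjoint: "star (coact T x) * y = star x * act T y"
  by transfer (auto intro: adjoint_sym)

lemma blinfun_eq_by_star:
  fixes T S :: "'a::cstar_algebra \<Rightarrow>\<^sub>L 'a"
  assumes "\<And>x y. star (T x) * y = star (S x) * y"
  shows "T = S"
proof (rule blinfun_eqI)
  fix x
  have "star (T x) = star (S x)" by (rule multiplication_faithful) (rule assms)
  then have "star (star (T x)) = star (star (S x))" by simp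
  then show "T x = S x" by (simp only: star_star)
qed

lemma adjointable_eqI: "act T = act S \<Longrightarrow> T = S"
proof -
  assume eq: "act T = act S"
  have "coact T = coact S"
    by (rule blinfun_eq_by_star) (simp add: coact_adjoint eq)
  with eq show ?thesis
    by transfer (auto simp: prod_eq_iff)
qed

text \<open>
  The operators in the type are only real-linear by construction; complex linearity is a consequence
  of having an adjoint.
\<close>
lemma act_scaleC: "act T (scaleC z x) = scaleC z (act T x)"
proof -
  have "star (act T (scaleC z x)) = star (scaleC z (act T x))"
    by (rule multiplication_faithful)
       (simp add: act_adjoint star_scaleC mult_scaleC_left)
  then have "star (star (act T (scaleC z x))) = star (star (scaleC z (act T x)))" by simp
  then show ?thesis by (simp only: star_star)
qed

lift_definition adj :: "'a::cstar_algebra adjointable \<Rightarrow> 'a adjointable"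
  is "\<lambda>(T, S). (S, T)"
  by (auto intro: adjoint_sym)

lemma act_adj: "act (adj T) = coact T" by transfer auto
lemma coact_adj: "coact (adj T) = act T" by transfer auto

text \<open>
  The nontrivial half of the \<open>C\<^sup>*\<close>-identity for operators. It is inherited pointwise:
  \<open>\<parallel>T x\<parallel>\<^sup>2 = \<parallel>star (T x) * T x\<parallel> = \<parallel>star x * T\<^sup>* (T x)\<parallel> \<le> \<parallel>T\<^sup>* T\<parallel> \<parallel>x\<parallel>\<^sup>2\<close>.
\<close>
lemma norm_act_le: "norm (act T) ^ 2 \<le> norm (coact T o\<^sub>L act T)"
proof -
  have "norm (act T) \<le> sqrt (norm (coact T o\<^sub>L act T))"
  proof (rule norm_blinfun_bound)
    fix x
    have "norm (act T x) ^ 2 = norm (star x * (coact T o\<^sub>L act T) x)"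
      by (simp add: cstar_identity[symmetric] act_adjoint)
    also have "\<dots> \<le> norm x * (norm (coact T o\<^sub>L act T) * norm x)"
      by (rule order.trans[OF norm_mult_ineq])
         (use norm_blinfun[of "coact T o\<^sub>L act T" x] in \<open>simp add: mult_left_mono\<close>)
    finally have "norm (act T x) ^ 2 \<le> (sqrt (norm (coact T o\<^sub>L act T)) * norm x)\<^sup>2"
      by (simp add: power_mult_distrib power2_eq_square algebra_simps)
    then show "norm (act T x) \<le> sqrt (norm (coact T o\<^sub>L act T)) * norm x"
      by (rule power2_le_imp_le) simp
  qed simp
  then have "(norm (act T))\<^sup>2 \<le> (sqrt (norm (coact T o\<^sub>L act T)))\<^sup>2"
    by (rule power_mono) simp
  then show ?thesis by simp
qed

lemma norm_coact: "norm (coact T) = norm (act T)"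
proof -
  have le: "norm (act S) \<le> norm (coact S)" for S :: "'a adjointable"
  proof (cases "norm (act S) = 0")
    case False
    have "norm (act S) * norm (act S) \<le> norm (coact S) * norm (act S)"
      using order.trans[OF norm_act_le norm_blinfun_compose] by (simp add: power2_eq_square)
    then show ?thesis using False by simp
  qed simp
  show ?thesis using le[of T] le[of "adj T"] by (simp add: act_adj coact_adj)
qed

instantiation adjointable :: (cstar_algebra) real_normed_algebra
begin

lift_definition zero_adjointable :: "'a adjointable" is "(0, 0)" by simp
lift_definition plus_adjointable :: "'a adjointable \<Rightarrow> 'a adjointable \<Rightarrow> 'a adjointable"
  is "\<lambda>(T, S) (T', S'). (T + T', S + S')"
  by (auto simp: blinfun.add_left star_add algebra_simps)
lift_definition minus_adjointable :: "'a adjointable \<Rightarrow> 'a adjointable \<Rightarrow> 'a adjointable"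
  is "\<lambda>(T, S) (T', S'). (T - T', S - S')"
  by (auto simp: blinfun.diff_left star_diff algebra_simps)
lift_definition uminus_adjointable :: "'a adjointable \<Rightarrow> 'a adjointable"
  is "\<lambda>(T, S). (- T, - S)"
  by (auto simp: blinfun.minus_left star_minus)
lift_definition times_adjointable :: "'a adjointable \<Rightarrow> 'a adjointable \<Rightarrow> 'a adjointable"
  is "\<lambda>(T, S) (T', S'). (T o\<^sub>L T', S' o\<^sub>L S)"
  by auto
lift_definition scaleR_adjointable :: "real \<Rightarrow> 'a adjointable \<Rightarrow> 'a adjointable"
  is "\<lambda>r (T, S). (r *\<^sub>R T, r *\<^sub>R S)"
  by (auto simp: blinfun.scaleR_left star_scaleR)
definition norm_adjointable :: "'a adjointable \<Rightarrow> real" where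
  "norm_adjointable T = norm (act T)"
definition dist_adjointable :: "'a adjointable \<Rightarrow> 'a adjointable \<Rightarrow> real" where
  "dist_adjointable T S = norm (T - S)"
definition uniformity_adjointable :: "('a adjointable \<times> 'a adjointable) filter" where
  "uniformity_adjointable = (INF e\<in>{0<..}. principal {(x, y). dist x y < e})"
definition open_adjointable :: "'a adjointable set \<Rightarrow> bool" where
  "open_adjointable U \<longleftrightarrow> (\<forall>x\<in>U. \<forall>\<^sub>F (x', y) in uniformity. x' = x \<longrightarrow> y \<in> U)"
definition sgn_adjointable :: "'a adjointable \<Rightarrow> 'a adjointable" where
  "sgn_adjointable T = inverse (norm T) *\<^sub>R T"

lemma act_zero: "act 0 = 0" by transfer simp
lemma act_plus: "act (T + S) = act T + act S" by transfer auto
lemma act_minus: "act (T - S) = act T - act S" by transfer auto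
lemma act_uminus: "act (- T) = - act T" by transfer auto
lemma act_times: "act (T * S) = act T o\<^sub>L act S" by transfer auto
lemma act_scaleR: "act (r *\<^sub>R T) = r *\<^sub>R act T" by transfer auto
lemmas act_simps = act_zero act_plus act_minus act_uminus act_times act_scaleR scaleC_blinfun.rep_eq

instance
proof
  fix T S R :: "'a adjointable" and r s :: real
  show "T + S + R = T + (S + R)"
    by (rule adjointable_eqI, simp add: act_simps)
  show "T + S = S + T"
    by (rule adjointable_eqI, simp add: act_simps)
  show "0 + T = T"
    by (rule adjointable_eqI, simp add: act_simps)
  show "- T + T = 0"
    by (rule adjointable_eqI, simp add: act_simps)
  show "T - S = T + - S"
    by (rule adjointable_eqI, simp add: act_simps)
  show "T * S * R = T * (S * R)"
    by (rule adjointable_eqI, rule blinfun_eqI,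
        simp add: act_simps blinfun.bilinear_simps algebra_simps)
  show "(T + S) * R = T * R + S * R"
    by (rule adjointable_eqI, rule blinfun_eqI,
        simp add: act_simps blinfun.bilinear_simps algebra_simps)
  show "R * (T + S) = R * T + R * S"
    by (rule adjointable_eqI, rule blinfun_eqI,
        simp add: act_simps blinfun.bilinear_simps algebra_simps)
  show "r *\<^sub>R (T + S) = r *\<^sub>R T + r *\<^sub>R S"
    by (rule adjointable_eqI, rule blinfun_eqI,
        simp add: act_simps blinfun.bilinear_simps algebra_simps)
  show "(r + s) *\<^sub>R T = r *\<^sub>R T + s *\<^sub>R T"
    by (rule adjointable_eqI, rule blinfun_eqI,
        simp add: act_simps blinfun.bilinear_simps algebra_simps)
  show "r *\<^sub>R s *\<^sub>R T = (r * s) *\<^sub>R T"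
    by (rule adjointable_eqI, rule blinfun_eqI,
        simp add: act_simps blinfun.bilinear_simps algebra_simps)
  show "1 *\<^sub>R T = T"
    by (rule adjointable_eqI, rule blinfun_eqI,
        simp add: act_simps blinfun.bilinear_simps algebra_simps)
  show "r *\<^sub>R T * S = r *\<^sub>R (T * S)"
    by (rule adjointable_eqI, rule blinfun_eqI,
        simp add: act_simps blinfun.bilinear_simps algebra_simps)
  show "T * r *\<^sub>R S = r *\<^sub>R (T * S)"
    by (rule adjointable_eqI, rule blinfun_eqI,
        simp add: act_simps blinfun.bilinear_simps algebra_simps)
  show "dist T S = norm (T - S)" "sgn T = inverse (norm T) *\<^sub>R T"
    "uniformity = (INF e\<in>{0<..}. principal {(x, y::'a adjointable). dist x y < e})"
    by (simp_all add: dist_adjointable_def sgn_adjointable_def uniformity_adjointable_def)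
  fix U :: "'a adjointable set"
  show "open U = (\<forall>x\<in>U. \<forall>\<^sub>F (x', y) in uniformity. x' = x \<longrightarrow> y \<in> U)"
    by (rule open_adjointable_def)
next
  fix T S :: "'a adjointable" and r :: real
  show "(norm T = 0) = (T = 0)"
    unfolding norm_adjointable_def using adjointable_eqI[of T 0] by (auto simp: act_simps)
  show "norm (T + S) \<le> norm T + norm S"
    by (simp add: norm_adjointable_def act_simps norm_triangle_ineq)
  show "norm (r *\<^sub>R T) = \<bar>r\<bar> * norm T"
    by (simp add: norm_adjointable_def act_simps)
  show "norm (T * S) \<le> norm T * norm S"
    by (simp add: norm_adjointable_def act_simps norm_blinfun_compose)
qed

end

instance adjointable :: (cstar_algebra) banach
proof
  fix X :: "nat \<Rightarrow> 'a adjointable"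
  assume X: "Cauchy X"
  have norms: "norm (act T - act S) = dist T S" "norm (coact T - coact S) = dist T S"
    for T S :: "'a adjointable"
  proof -
    show "norm (act T - act S) = dist T S"
      by (simp add: dist_adjointable_def norm_adjointable_def act_simps)
    have "coact T - coact S = coact (T - S)" by transfer auto
    then show "norm (coact T - coact S) = dist T S"
      by (simp add: norm_coact dist_adjointable_def norm_adjointable_def)
  qed
  have "dist (act T) (act S) = dist T S" "dist (coact T) (coact S) = dist T S" for T S :: "'a adjointable"
    by (simp_all only: norms dist_norm[of "act T"] dist_norm[of "coact T"])
  then have "Cauchy (\<lambda>n. act (X n))" "Cauchy (\<lambda>n. coact (X n))"
    using X by (simp_all only: Cauchy_def)
  then obtain T S where T: "(\<lambda>n. act (X n)) \<longlonglongrightarrow> T" and S: "(\<lambda>n. coact (X n)) \<longlonglongrightarrow> S"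
    using Cauchy_convergent convergent_def by blast
  have adj: "star (T x) * y = star x * S y" for x y
  proof (rule LIMSEQ_unique)
    show "(\<lambda>n. star (act (X n) x) * y) \<longlonglongrightarrow> star (T x) * y"
      by (intro tendsto_intros bounded_linear.tendsto[OF bounded_linear_star] T)
    show "(\<lambda>n. star (act (X n) x) * y) \<longlonglongrightarrow> star x * S y"
      unfolding act_adjoint by (intro tendsto_intros S)
  qed
  define L where "L = Abs_adjointable (T, S)"
  have L: "act L = T"
    using adj by (simp add: L_def act.rep_eq Abs_adjointable_inverse)
  have "dist (act (X n)) T = dist (X n) L" for n
    by (simp only: norms dist_norm[of "act (X n)"] flip: L)
  then have "X \<longlonglongrightarrow> L"
    using T by (simp only: tendsto_iff)
  then show "convergent X" by (auto simp: convergent_def)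
qed

instantiation adjointable :: (cstar_algebra) cstar_algebra
begin

lift_definition scaleC_adjointable :: "complex \<Rightarrow> 'a adjointable \<Rightarrow> 'a adjointable"
  is "\<lambda>z (T, S). (scaleC_blinfun z o\<^sub>L T, scaleC_blinfun (cnj z) o\<^sub>L S)"
  by (auto simp: scaleC_blinfun.rep_eq star_scaleC mult_scaleC_left mult_scaleC_right)
definition star_adjointable :: "'a adjointable \<Rightarrow> 'a adjointable" where
  "star_adjointable = adj"

lemma act_scaleC_left: "act (scaleC z T) = scaleC_blinfun z o\<^sub>L act T" by transfer auto
lemma act_star: "act (star T) = coact T" by (simp add: star_adjointable_def act_adj)

instance
proof
  fix T S :: "'a adjointable" and r :: real and z w :: complex
  show "scaleC z (T + S) = scaleC z T + scaleC z S"
    by (rule adjointable_eqI, rule blinfun_eqI,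
        simp add: act_simps act_scaleC_left blinfun.bilinear_simps scaleC_add_right scaleC_add_left
          scaleC_scaleC act_scaleC)
  show "scaleC (z + w) T = scaleC z T + scaleC w T"
    by (rule adjointable_eqI, rule blinfun_eqI,
        simp add: act_simps act_scaleC_left blinfun.bilinear_simps scaleC_add_right scaleC_add_left
          scaleC_scaleC act_scaleC)
  show "scaleC z (scaleC w T) = scaleC (z * w) T"
    by (rule adjointable_eqI, rule blinfun_eqI,
        simp add: act_simps act_scaleC_left blinfun.bilinear_simps scaleC_add_right scaleC_add_left
          scaleC_scaleC act_scaleC)
  show "scaleC z T * S = scaleC z (T * S)"
    by (rule adjointable_eqI, rule blinfun_eqI,
        simp add: act_simps act_scaleC_left blinfun.bilinear_simps scaleC_add_right scaleC_add_left
          scaleC_scaleC act_scaleC)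
  show "T * scaleC z S = scaleC z (T * S)"
    by (rule adjointable_eqI, rule blinfun_eqI,
        simp add: act_simps act_scaleC_left blinfun.bilinear_simps scaleC_add_right scaleC_add_left
          scaleC_scaleC act_scaleC)
  show "r *\<^sub>R T = scaleC (complex_of_real r) T"
    by (rule adjointable_eqI, rule blinfun_eqI,
        simp add: act_simps act_scaleC_left blinfun.bilinear_simps scaleR_scaleC)
  show "star (star T) = T" unfolding star_adjointable_def by transfer auto
  show "star (T + S) = star T + star S" unfolding star_adjointable_def by transfer auto
  show "star (scaleC z T) = scaleC (cnj z) (star T)" unfolding star_adjointable_def by transfer auto
  show "star (T * S) = star S * star T" unfolding star_adjointable_def by transfer auto
  show "norm (scaleC z T) = cmod z * norm T"
  proof -
    have le: "norm (scaleC z T) \<le> cmod z * norm T" for z and T :: "'a adjointable"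
      unfolding norm_adjointable_def act_scaleC_left
      by (rule order.trans[OF norm_blinfun_compose], rule mult_right_mono[OF norm_blinfun_bound])
         (auto simp: act_simps norm_scaleC)
    show ?thesis
    proof (cases "z = 0")
      case True then show ?thesis using le[of z T] by (simp add: norm_adjointable_def)
    next
      case False
      have "T = scaleC (inverse z) (scaleC z T)"
        by (rule adjointable_eqI, rule blinfun_eqI)
           (use False in \<open>simp add: act_simps act_scaleC_left scaleC_scaleC\<close>)
      then have "norm T \<le> inverse (cmod z) * norm (scaleC z T)"
        using le[of "inverse z" "scaleC z T"] by (simp add: norm_inverse)
      then have "cmod z * norm T \<le> norm (scaleC z T)"
        using False by (simp add: field_simps)
      with le[of z T] show ?thesis by simp
    qed
  qed
  show "norm (star T * T) = (norm T)\<^sup>2"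
  proof (rule antisym)
    show "norm (star T * T) \<le> (norm T)\<^sup>2"
      using norm_blinfun_compose[of "coact T" "act T"]
      by (simp add: norm_adjointable_def act_simps act_star norm_coact power2_eq_square)
    show "(norm T)\<^sup>2 \<le> norm (star T * T)"
      using norm_act_le[of T] by (simp add: norm_adjointable_def act_simps act_star)
  qed
qed

end

text \<open>
  The class does not demand \<open>0 \<noteq> 1\<close>, because the multiplier algebra of the zero algebra is zero.
  For the same reason the norm of the unit is only known to be at most \<open>1\<close>.
\<close>
class unital_cstar_algebra = cstar_algebra + monoid_mult

instantiation adjointable :: (cstar_algebra) unital_cstar_algebra
begin

lift_definition one_adjointable :: "'a adjointable" is "(id_blinfun, id_blinfun)" by simp

lemma act_one: "act 1 = id_blinfun" by transfer simp

instance
  by standard (rule adjointable_eqI, rule blinfun_eqI, simp add: act_simps act_one)+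

end

lift_definition left_mult :: "'a::cstar_algebra \<Rightarrow> 'a adjointable"
  is "\<lambda>a. (blinfun_mult_right a, blinfun_mult_right (star a))"
  by (auto simp: star_mult mult.assoc)

lemma act_left_mult: "act (left_mult a) x = a * x"
  by transfer simp

lemma coact_left_mult: "coact (left_mult a) x = star a * x"
  by transfer simp

lemma left_mult_add: "left_mult (a + b) = left_mult a + left_mult b"
  by (rule adjointable_eqI, rule blinfun_eqI)
     (simp add: act_simps act_left_mult blinfun.bilinear_simps algebra_simps)

lemma left_mult_zero: "left_mult 0 = 0"
  using left_mult_add[of 0 0] by simp

lemma left_mult_mult: "left_mult (a * b) = left_mult a * left_mult b"
  by (rule adjointable_eqI, rule blinfun_eqI) (simp add: act_simps act_left_mult mult.assoc)

lemma left_mult_star: "left_mult (star a) = star (left_mult a)"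
  by (rule adjointable_eqI, rule blinfun_eqI) (simp add: act_star act_left_mult coact_left_mult)

text \<open>
  The embedding of \<open>A\<close> is isometric because the lower bound is attained at \<open>star a\<close>.
\<close>
lemma norm_left_mult: "norm (left_mult a) = norm a"
proof (rule antisym)
  show "norm (left_mult a) \<le> norm a"
    unfolding norm_adjointable_def
    by (rule norm_blinfun_bound) (auto simp: act_left_mult norm_mult_ineq)
  have "(norm a)\<^sup>2 = norm (act (left_mult a) (star a))"
    using cstar_identity[of "star a"] by (simp add: act_left_mult star_star)
  also have "\<dots> \<le> norm (left_mult a) * norm a"
    using norm_blinfun[of "act (left_mult a)" "star a"] by (simp add: norm_adjointable_def)
  finally show "norm a \<le> norm (left_mult a)"
    by (cases "a = 0") (simp_all add: power2_eq_square)
qed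

lemma left_mult_sum: "left_mult (sum f I) = (\<Sum>i\<in>I. left_mult (f i))"
  by (induction I rule: infinite_finite_induct) (auto simp: left_mult_add left_mult_zero)

section \<open>Square roots\<close>

lemma star_one [simp]: "star 1 = (1::'a::unital_cstar_algebra)"
proof -
  have "star (star 1 * 1) = star 1 * star (star (1::'a))" by (rule star_mult)
  then show ?thesis by (simp add: star_star)
qed

lemma norm_one_le: "norm (1::'a::unital_cstar_algebra) \<le> 1"
  using cstar_identity[of "1::'a"] by (cases "norm (1::'a) = 0") (simp_all add: power2_eq_square)

lemma norm_power_le: "norm (k ^ n) \<le> norm (k::'a::unital_cstar_algebra) ^ n"
proof (induction n)
  case (Suc n)
  then show ?case
    using order.trans[OF norm_mult_ineq[of k "k ^ n"]] by (simp add: mult_left_mono)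
qed (simp add: norm_one_le)

text \<open>
  The Taylor coefficients of \<open>sqrt (1 - t)\<close>. All of them except the first are nonpositive and their
  partial sums stay nonnegative, so the series converges absolutely on the closed unit disc. The
  boundary matters: it allows roots of elements \<open>1 - k\<close> with \<open>norm k = 1\<close>, which have no
  inverse in general.
\<close>
definition sqrt_coeff :: "nat \<Rightarrow> real" where
  "sqrt_coeff n = (-1) ^ n * ((1/2) gchoose n)"

lemma sqrt_coeff_0 [simp]: "sqrt_coeff 0 = 1"
  by (simp add: sqrt_coeff_def)

lemma neg_power_gbinomial: "(-1) ^ n * (a gchoose n) = pochhammer (- a) n / fact n" for a :: real
  by (simp add: gbinomial_pochhammer flip: power_add mult_2)

lemma sqrt_coeff_Suc_nonpos: "sqrt_coeff (Suc n) \<le> 0"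
proof -
  have "pochhammer (- (1/2)) (Suc n) = (- (1/2)) * pochhammer (1/2 :: real) n"
    by (simp add: pochhammer_rec)
  moreover have "pochhammer (1/2 :: real) n \<ge> 0" by (simp add: pochhammer_nonneg)
  ultimately have "pochhammer (- (1/2) :: real) (Suc n) \<le> 0" by simp
  then show ?thesis unfolding sqrt_coeff_def neg_power_gbinomial
    by (simp add: divide_nonpos_pos del: pochhammer_Suc)
qed

text \<open>
  Partial sums of alternating binomial coefficients telescope to the coefficients of
  \<open>(1 - t) powr (-1/2)\<close>, which are nonnegative.
\<close>
lemma sum_abs_sqrt_coeff_le: "(\<Sum>i<n. \<bar>sqrt_coeff (Suc i)\<bar>) \<le> 1"
proof -
  have "0 \<le> pochhammer (1/2 :: real) n / fact n" by (simp add: pochhammer_nonneg)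
  also have "\<dots> = (\<Sum>i\<le>n. sqrt_coeff i)"
    using gbinomial_sum_lower_neg[of "1/2 :: real" n] neg_power_gbinomial[of n "-(1/2)"]
    by (simp add: sqrt_coeff_def mult.commute)
  also have "\<dots> = 1 + (\<Sum>i<n. sqrt_coeff (Suc i))"
    by (simp add: sum.atMost_shift)
  finally have "- (\<Sum>i<n. sqrt_coeff (Suc i)) \<le> 1" by simp
  then show ?thesis
    by (simp add: abs_of_nonpos sqrt_coeff_Suc_nonpos sum_negf)
qed

lemma summable_abs_sqrt_coeff: "summable (\<lambda>n. \<bar>sqrt_coeff n\<bar>)"
proof -
  have "summable (\<lambda>n. \<bar>sqrt_coeff (Suc n)\<bar>)"
    by (rule summableI_nonneg_bounded[where x = 1]) (simp_all add: sum_abs_sqrt_coeff_le)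
  then show ?thesis by (subst summable_Suc_iff[symmetric])
qed

text \<open>
  This is the coefficientwise form of \<open>sqrt (1 - t) * sqrt (1 - t) = 1 - t\<close>, read off from
  Vandermonde's identity.
\<close>
lemma sqrt_coeff_convolution:
  "(\<Sum>i\<le>n. sqrt_coeff i * sqrt_coeff (n - i)) = (if n = 0 then 1 else if n = 1 then -1 else 0)"
proof -
  have "(\<Sum>i\<le>n. sqrt_coeff i * sqrt_coeff (n - i))
      = (-1) ^ n * (\<Sum>i\<le>n. ((1/2) gchoose i) * ((1/2) gchoose (n - i)))"
    unfolding sum_distrib_left
    by (rule sum.cong) (auto simp: sqrt_coeff_def algebra_simps simp flip: power_add)
  also have "(\<Sum>i\<le>n. ((1/2::real) gchoose i) * ((1/2) gchoose (n - i))) = (1 gchoose n)"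
    using gbinomial_Vandermonde[of "1/2::real" "1/2" n] by (simp add: atMost_atLeast0)
  also have "(1::real) gchoose n = of_nat (1 choose n)"
    using binomial_gbinomial[of 1 n, where ?'a = real] by simp
  finally show ?thesis
    by (auto simp: binomial_eq_0)
qed

lemma star_power: "star (k ^ n) = star (k::'a::unital_cstar_algebra) ^ n"
  by (induction n) (simp_all add: star_mult power_commutes)

text \<open>
  Besides being a square root, the sum \<open>w\<close> of the series satisfies two facts that later arguments rest
  on. The bound on \<open>1 - w\<close>, which is the sum of the series without its constant term, will say that the
  root is again positive; the commutation clause stands for \<open>w\<close> lying in the closed algebra
  generated by \<open>k\<close>.
\<close>
lemma sqrt_one_minus:
  fixes k :: "'a::unital_cstar_algebra"
  assumes sa: "star k = k" and k: "norm k \<le> 1"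
  obtains w where "star w = w" "w * w = 1 - k" "norm (1 - w) \<le> 1"
    "\<And>y. y * k = k * y \<Longrightarrow> y * w = w * y"
proof -
  let ?f = "\<lambda>n. sqrt_coeff n *\<^sub>R k ^ n"
  define w where "w = suminf ?f"
  have norm_f: "norm (?f n) \<le> \<bar>sqrt_coeff n\<bar>" for n
  proof -
    have "norm (k ^ n) \<le> 1"
      using norm_power_le[of k n] k by (meson norm_ge_zero order.trans power_le_one)
    then show ?thesis by (simp add: mult_left_le)
  qed
  have norm_summable: "summable (\<lambda>n. norm (?f n))"
    by (rule summable_comparison_test'[OF summable_abs_sqrt_coeff, where N = 0]) (use norm_f in auto)
  then have summable: "summable ?f" by (rule summable_norm_cancel)
  have "star w = (\<Sum>n. star (?f n))"
    unfolding w_def by (rule bounded_linear.suminf[OF bounded_linear_star summable])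
  then have "star w = w" by (simp add: star_scaleR star_power sa w_def)
  moreover have "w * w = 1 - k"
  proof -
    have "(\<lambda>n. \<Sum>i\<le>n. ?f i * ?f (n - i)) sums (w * w)"
      unfolding w_def by (rule Cauchy_product_sums[OF norm_summable norm_summable])
    also have "(\<lambda>n. \<Sum>i\<le>n. ?f i * ?f (n - i))
        = (\<lambda>n. (if n = 0 then 1 else if n = 1 then -1 else 0) *\<^sub>R k ^ n)"
    proof
      fix n
      have "(\<Sum>i\<le>n. ?f i * ?f (n - i)) = (\<Sum>i\<le>n. (sqrt_coeff i * sqrt_coeff (n - i)) *\<^sub>R k ^ n)"
        by (rule sum.cong) (auto simp flip: power_add)
      then show "(\<Sum>i\<le>n. ?f i * ?f (n - i))
          = (if n = 0 then 1 else if n = 1 then -1 else 0) *\<^sub>R k ^ n"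
        by (simp only: scaleR_sum_left[symmetric] sqrt_coeff_convolution)
    qed
    finally have lhs: "(\<lambda>n. (if n = 0 then 1 else if n = 1 then -1 else 0) *\<^sub>R k ^ n) sums (w * w)" .
    have "(\<lambda>n. (if n = 0 then 1 else if n = 1 then -1 else 0) *\<^sub>R k ^ n) sums
        (\<Sum>n\<in>{0, 1}. (if n = 0 then 1 else if n = 1 then -1 else 0) *\<^sub>R k ^ n)"
      by (rule sums_finite) auto
    with lhs show ?thesis using sums_unique2 by fastforce
  qed
  moreover have "norm (1 - w) \<le> 1"
  proof -
    have tail: "1 - w = - (\<Sum>n. ?f (Suc n))"
      using suminf_split_head[OF summable] by (simp add: w_def)
    have abs_tail: "summable (\<lambda>n. \<bar>sqrt_coeff (Suc n)\<bar>)"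
      using summable_abs_sqrt_coeff by (subst summable_Suc_iff)
    have "norm (\<Sum>n. ?f (Suc n)) \<le> (\<Sum>n. \<bar>sqrt_coeff (Suc n)\<bar>)"
      by (rule norm_suminf_le[OF norm_f abs_tail])
    also have "\<dots> \<le> 1"
      by (rule suminf_le_const[OF abs_tail sum_abs_sqrt_coeff_le])
    finally show ?thesis unfolding tail by simp
  qed
  moreover have "y * w = w * y" if "y * k = k * y" for y
  proof -
    have "y * k ^ n = k ^ n * y" for n
      using that by (metis power_commuting_commutes)
    then have "(\<Sum>n. y * ?f n) = (\<Sum>n. ?f n * y)" by simp
    then show ?thesis
      unfolding w_def suminf_mult[OF summable] suminf_mult2[OF summable] .
  qed
  ultimately show ?thesis using that by blast
qed

section \<open>Positive elements\<close>

abbreviation times_i :: "'a::cstar_algebra \<Rightarrow> 'a" where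
  "times_i v \<equiv> scaleC \<i> v"

lemma scaleC_minus_right: "scaleC z (- x) = - scaleC z (x::'a::cstar_algebra)"
  using scaleC_scaleC[of z "-1" x] scaleC_scaleC[of "-1" z x] by (simp add: scaleC_minus_one)

lemma scaleC_minus_left: "scaleC (- z) x = - scaleC z (x::'a::cstar_algebra)"
  using scaleC_scaleC[of "-1" z x] by (simp add: scaleC_minus_one)

lemma scaleC_diff_right: "scaleC z (x - y) = scaleC z x - scaleC z (y::'a::cstar_algebra)"
  using scaleC_add_right[of z x "- y"] by (simp add: scaleC_minus_right)

lemma times_i_times_i: "times_i (times_i v) = - v"
  by (simp add: scaleC_scaleC scaleC_minus_one)

lemma star_times_i: "star (times_i v) = - times_i (star v)"
  by (simp add: star_scaleC scaleC_minus_left)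

text \<open>
  For commuting self-adjoint \<open>u\<close> and \<open>v\<close> the sum of squares is \<open>star x * x\<close> with \<open>x = u + \<i> v\<close>, and \<open>u\<close> is
  the real part of \<open>x\<close>, so \<open>norm u \<le> norm x\<close>. This comparison uses the complex scalars, as it must:
  on the complex numbers with trivial involution, a real algebra satisfying the norm identity,
  the inequality is false for \<open>u = 1\<close> and \<open>v = \<i>\<close>.
\<close>
lemma cartesian_norm_bound:
  fixes u v :: "'a::cstar_algebra"
  assumes "star u = u" "star v = v"
    and commute: "u * v = v * u" and bound: "norm (u * u + v * v) \<le> t"
  shows "norm (u * u) \<le> t" 
proof -
  define x where "x = u + times_i v"
  have star_x: "star x = u - times_i v"
    using assms by (simp add: x_def star_add star_times_i)
  have "star x * x = u * u + v * v"
    unfolding star_x unfolding x_def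
    by (simp add: algebra_simps mult_scaleC_left mult_scaleC_right times_i_times_i commute scaleC_minus_right
        scaleC_add_right scaleC_diff_right)
  then have "(norm x)\<^sup>2 \<le> t"
    using cstar_identity[of x] bound by simp
  moreover have "norm u \<le> norm x"
  proof -
    have "x + star x = 2 *\<^sub>R u"
      unfolding star_x unfolding x_def by (simp add: scaleR_2)
    then have "norm (x + star x) = 2 * norm u" by simp
    then show ?thesis using norm_triangle_ineq[of x "star x"] by simp
  qed
  ultimately have "(norm u)\<^sup>2 \<le> t"
    using power_mono[of "norm u" "norm x" 2] by (meson norm_ge_zero order.trans)
  then show ?thesis
    using norm_mult_ineq[of u u] by (simp add: power2_eq_square)
qed

lemma norm_square: "star u = u \<Longrightarrow> norm (u * u) = (norm (u::'a::cstar_algebra))\<^sup>2"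
  using cstar_identity[of u] by simp

lemma norm_scaleR_one_le: "t \<ge> 0 \<Longrightarrow> norm (t *\<^sub>R (1::'a::unital_cstar_algebra)) \<le> t"
  using norm_one_le[where 'a = 'a] by (simp add: mult_left_le)

text \<open>
  Spectrally, a self-adjoint \<open>h\<close> whose spectrum lies in a ball of radius \<open>t\<close> around \<open>t\<close> has nonnegative
  spectrum. Expressing positivity by a norm makes it obvious that sums of positive elements are
  positive; the price is that \<open>h * h\<close> and \<open>star x * x\<close> require work.
\<close>
definition positive :: "'a::unital_cstar_algebra \<Rightarrow> bool" where
  "positive h \<longleftrightarrow> star h = h \<and> (\<exists>t\<ge>0. norm (t *\<^sub>R 1 - h) \<le> t)"

lemma positive_selfadjoint: "positive h \<Longrightarrow> star h = h"
  by (simp add: positive_def)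

lemma positive_zero: "positive 0"
  by (auto simp: positive_def intro!: exI[of _ 0])

lemma positive_add:
  assumes "positive g" "positive h"
  shows "positive (g + h)"
proof -
  obtain s t where st: "s \<ge> 0" "norm (s *\<^sub>R 1 - g) \<le> s" "t \<ge> 0" "norm (t *\<^sub>R 1 - h) \<le> t"
    using assms by (auto simp: positive_def)
  have "norm ((s + t) *\<^sub>R 1 - (g + h)) \<le> s + t"
    using norm_triangle_ineq[of "s *\<^sub>R 1 - g" "t *\<^sub>R 1 - h"] st
    by (simp add: algebra_simps)
  then show ?thesis
    using st assms by (auto simp: positive_def star_add intro!: exI[of _ "s + t"])
qed

lemma positive_scaleR:
  assumes "positive h" "r \<ge> 0"
  shows "positive (r *\<^sub>R h)"
proof -
  obtain t where t: "t \<ge> 0" "norm (t *\<^sub>R 1 - h) \<le> t"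
    using assms by (auto simp: positive_def)
  have "norm ((r * t) *\<^sub>R 1 - r *\<^sub>R h) = r * norm (t *\<^sub>R 1 - h)"
    using \<open>r \<ge> 0\<close> norm_scaleR[of r "t *\<^sub>R 1 - h"] by (simp add: algebra_simps)
  also have "\<dots> \<le> r * t" using t \<open>r \<ge> 0\<close> by (simp add: mult_left_mono)
  finally show ?thesis
    using assms t by (auto simp: positive_def star_scaleR intro!: exI[of _ "r * t"])
qed

text \<open>
  The inequality \<open>h \<le> \<parallel>h\<parallel> 1\<close>: with radius \<open>t\<close>, the defining norm condition is the bound on \<open>h\<close> itself.
\<close>
lemma positive_const_minus:
  assumes "star h = h" "norm h \<le> t"
  shows "positive (t *\<^sub>R 1 - h)"
  unfolding positive_def
  using assms order.trans[OF norm_ge_zero] by (auto simp: star_diff star_scaleR intro!: exI[of _ t])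

text \<open>
  After rescaling, positivity of \<open>h\<close> says that \<open>h = 1 - k\<close> with \<open>norm k \<le> 1\<close>, which is exactly the
  domain of the binomial series.
\<close>
lemma positive_sqrt:
  assumes "positive h"
  obtains m where "positive m" "m * m = h" "\<And>y. y * h = h * y \<Longrightarrow> y * m = m * y"
proof -
  obtain t where t: "t \<ge> 0" "norm (t *\<^sub>R 1 - h) \<le> t" and sa: "star h = h"
    using assms by (auto simp: positive_def)
  show ?thesis
  proof (cases "t = 0")
    case True
    then have "h = 0" using t by simp
    then show ?thesis using that[of 0] positive_zero by simp
  next
    case False
    with t have pos: "t > 0" by simp
    define k where "k = 1 - (1 / t) *\<^sub>R h"
    have "t *\<^sub>R k = t *\<^sub>R 1 - h" using pos by (simp add: k_def algebra_simps)
    then have "t * norm k \<le> t" using t pos norm_scaleR[of t k] by simp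
    then have norm_k: "norm k \<le> 1" using pos by simp
    have sa_k: "star k = k" by (simp add: k_def star_diff star_scaleR sa)
    obtain w where w: "star w = w" "w * w = 1 - k" "norm (1 - w) \<le> 1"
      and comm: "\<And>y. y * k = k * y \<Longrightarrow> y * w = w * y"
      by (rule sqrt_one_minus[OF sa_k norm_k]) blast
    define m where "m = sqrt t *\<^sub>R w"
    have "norm (sqrt t *\<^sub>R 1 - m) = sqrt t * norm (1 - w)"
      using norm_scaleR[of "sqrt t" "1 - w"] pos by (simp add: m_def algebra_simps)
    also have "\<dots> \<le> sqrt t" using w pos by (simp add: mult_left_le)
    finally have "positive m"
      using w pos by (auto simp: positive_def m_def star_scaleR intro!: exI[of _ "sqrt t"])
    moreover have "m * m = h"
      using pos by (simp add: m_def w k_def)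
    moreover have "y * m = m * y" if "y * h = h * y" for y
    proof -
      have "y * k = k * y" using that by (simp add: k_def algebra_simps)
      from comm[OF this] show ?thesis by (simp add: m_def)
    qed
    ultimately show ?thesis using that by blast
  qed
qed

text \<open>
  With \<open>w\<close> a square root of \<open>t - h\<^sup>2\<close>, the commuting elements \<open>w\<close> and \<open>h\<close> have \<open>w\<^sup>2 + h\<^sup>2 = t\<close>, so
  \<open>norm (w\<^sup>2) \<le> t\<close>; but \<open>w\<^sup>2 = t - h\<^sup>2\<close>, and this is the norm condition defining positivity.
\<close>
lemma positive_square:
  fixes h :: "'a::unital_cstar_algebra"
  assumes sa: "star h = h"
  shows "positive (h * h)"
proof -
  define t where "t = norm (h * h) + 1"
  have t: "t > 0" by (simp add: t_def add_nonneg_pos)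
  have p: "positive (t *\<^sub>R 1 - h * h)"
    by (rule positive_const_minus) (simp_all add: star_mult sa t_def)
  obtain w where w: "positive w" "w * w = t *\<^sub>R 1 - h * h"
    and comm: "\<And>y. y * (t *\<^sub>R 1 - h * h) = (t *\<^sub>R 1 - h * h) * y \<Longrightarrow> y * w = w * y"
    by (rule positive_sqrt[OF p]) blast
  have "h * w = w * h" by (rule comm) (simp add: algebra_simps)
  moreover have "norm (w * w + h * h) \<le> t"
    using w t norm_scaleR_one_le[of t] by (simp del: norm_scaleR)
  ultimately have "norm (w * w) \<le> t"
    by (intro cartesian_norm_bound[of w h]) (simp_all add: sa positive_selfadjoint w)
  then show ?thesis
    using t w sa by (auto simp: positive_def star_mult intro!: exI[of _ t])
qed

text \<open>
  Put \<open>t = norm (a + b)\<close>. Then \<open>t - a = (t - (a + b)) + b\<close> is positive, and the square roots of \<open>a\<close> and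
  \<open>t - a\<close> are commuting elements whose squares add up to \<open>t\<close>.
\<close>
lemma norm_le_norm_add_positive:
  assumes "positive a" "positive b"
  shows "norm a \<le> norm (a + b)"
proof -
  define t where "t = norm (a + b)"
  have "positive (t *\<^sub>R 1 - (a + b))"
    by (rule positive_const_minus) (simp_all add: t_def positive_selfadjoint assms positive_add)
  then have "positive (t *\<^sub>R 1 - (a + b) + b)" by (rule positive_add) (rule assms)
  then have c: "positive (t *\<^sub>R 1 - a)" by simp
  obtain v where v: "positive v" "v * v = a"
    by (rule positive_sqrt[OF assms(1)]) blast
  obtain q where q: "positive q" "q * q = t *\<^sub>R 1 - a"
    and comm: "\<And>y. y * (t *\<^sub>R 1 - a) = (t *\<^sub>R 1 - a) * y \<Longrightarrow> y * q = q * y"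
    by (rule positive_sqrt[OF c]) blast
  have "v * q = q * v"
    by (rule comm) (simp add: algebra_simps flip: v(2))
  moreover have "norm (v * v + q * q) \<le> t"
    using norm_scaleR_one_le[of t] by (simp add: v q t_def del: norm_scaleR)
  ultimately have "norm (v * v) \<le> t"
    by (intro cartesian_norm_bound[of v q]) (simp_all add: positive_selfadjoint v q)
  then show ?thesis by (simp add: v t_def)
qed

text \<open>
  With \<open>a\<close> and \<open>b\<close> twice the real and imaginary parts of \<open>y\<close>, one has
  \<open>2 (y * star y) = a\<^sup>2 + b\<^sup>2 + 2 z\<^sup>2\<close>, so \<open>y * star y\<close> is positive whereas \<open>star y * y\<close> is negative.
  Classically this is absurd for \<open>y \<noteq> 0\<close> because the two products have the same nonzero spectrum. A
  norm comparison replaces spectra here: for \<open>t = \<parallel>y\<parallel>\<^sup>2\<close> one has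
  \<open>(t - y * star y) * y = y * (t + z\<^sup>2)\<close>. The left side has squared norm at most \<open>t\<^sup>3\<close>, its first
  factor having norm at most \<open>t\<close>; the right side has squared norm at least \<open>2 t\<^sup>3\<close>, since expanding it
  produces the positive term \<open>2 t z\<^sup>4\<close>.
\<close>
lemma star_mult_self_eq_minus_square:
  fixes y z :: "'a::unital_cstar_algebra"
  assumes z: "star z = z" and y: "star y * y = - (z * z)"
  shows "y = 0"
proof -
  define a where "a = y + star y"
  define b where "b = times_i (star y - y)"
  have "star a = a" by (simp add: a_def star_add star_star add.commute)
  moreover have "star b = b"
    by (simp add: b_def star_times_i star_diff star_star) (simp flip: scaleC_minus_right)
  ultimately have "positive (a * a + b * b + 2 *\<^sub>R (z * z))"
    by (intro positive_add positive_scaleR positive_square z) auto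
  moreover have "a * a + b * b + 2 *\<^sub>R (z * z) = 2 *\<^sub>R (y * star y)"
  proof -
    have "b * b = - ((star y - y) * (star y - y))"
      by (simp add: b_def mult_scaleC_left mult_scaleC_right times_i_times_i)
    then have "a * a + b * b = 2 *\<^sub>R (y * star y) + 2 *\<^sub>R (star y * y)"
      by (simp add: a_def algebra_simps scaleR_2)
    then show ?thesis by (simp add: y)
  qed
  ultimately have "positive (2 *\<^sub>R (y * star y))" by simp
  from positive_scaleR[OF this, of "1/2"] have pos: "positive (y * star y)" by simp
  define t where "t = norm y ^ 2"
  have t: "norm (z * z) = t" "norm z ^ 2 = t"
    using cstar_identity[of y] norm_square[OF z] by (simp_all add: y t_def)
  have ny: "norm (y * star y) = t"
    using cstar_identity[of "star y"] by (simp add: star_star t_def)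
  define c where "c = t *\<^sub>R 1 - y * star y"
  have "positive c"
    unfolding c_def by (rule positive_const_minus) (simp_all add: positive_selfadjoint pos ny)
  then have "norm c \<le> norm (c + y * star y)"
    by (rule norm_le_norm_add_positive) (rule pos)
  also have "\<dots> \<le> t"
    using norm_scaleR_one_le[of t] by (simp add: c_def t_def del: norm_scaleR)
  finally have c: "norm c \<le> t" .
  have cy: "c * y = y * (t *\<^sub>R 1 + z * z)"
    by (simp add: c_def left_diff_distrib distrib_left mult.assoc y)
  define Z where "Z = z * z"
  have sa_Z: "star Z = Z" by (simp add: Z_def star_mult z)
  have pos_Z: "positive Z" "positive (Z * Z)" "positive (Z * (Z * Z))"
    using positive_square[OF z] positive_square[OF sa_Z] positive_square[of "z * Z"]
    by (simp_all add: Z_def star_mult z mult.assoc)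
  have "star (c * y) * (c * y) = - (t\<^sup>2 *\<^sub>R Z + Z * (Z * Z) + (2 * t) *\<^sub>R (Z * Z))"
  proof -
    have "star (c * y) * (c * y) = (t *\<^sub>R 1 + Z) * (star y * y) * (t *\<^sub>R 1 + Z)"
      by (simp add: cy star_mult star_add star_scaleR z Z_def mult.assoc)
    also have "\<dots> = - ((t *\<^sub>R 1 + Z) * Z * (t *\<^sub>R 1 + Z))"
      by (simp add: y Z_def)
    also have "\<dots> = - (t\<^sup>2 *\<^sub>R Z + Z * (Z * Z) + (2 * t) *\<^sub>R (Z * Z))"
      by (simp add: algebra_simps power2_eq_square scaleR_2 flip: scaleR_scaleR)
    finally show ?thesis .
  qed
  then have "norm ((2 * t) *\<^sub>R (Z * Z) + (t\<^sup>2 *\<^sub>R Z + Z * (Z * Z))) = (norm (c * y))\<^sup>2"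
    using cstar_identity[of "c * y"] by (simp add: add.commute norm_minus_cancel del: minus_add_distrib)
  moreover have "norm ((2 * t) *\<^sub>R (Z * Z)) \<le> norm ((2 * t) *\<^sub>R (Z * Z) + (t\<^sup>2 *\<^sub>R Z + Z * (Z * Z)))"
    by (intro norm_le_norm_add_positive positive_add positive_scaleR pos_Z) (simp_all add: t_def)
  moreover have "norm ((2 * t) *\<^sub>R (Z * Z)) = 2 * t ^ 3"
    using norm_square[OF sa_Z] t(1) by (simp add: Z_def t_def power3_eq_cube power2_eq_square)
  moreover have "(norm (c * y))\<^sup>2 \<le> t ^ 3"
  proof -
    have "norm (c * y) \<le> t * norm y"
      using order.trans[OF norm_mult_ineq mult_right_mono[OF c norm_ge_zero]] .
    then have "(norm (c * y))\<^sup>2 \<le> (t * norm y)\<^sup>2" by (rule power_mono) simp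
    then show ?thesis by (simp add: power_mult_distrib t_def power3_eq_cube power2_eq_square mult_ac)
  qed
  ultimately have "t ^ 3 \<le> 0" by linarith
  then have "t = 0" by (simp add: t_def)
  then show "y = 0" by (simp add: t_def)
qed

text \<open>
  Let \<open>h = star x * x\<close>, let \<open>m\<close> be its modulus, the root of \<open>h\<^sup>2\<close>, and let \<open>n = m - h\<close> be twice its negative
  part. Because \<open>h n = - m n\<close>, compressing by \<open>n\<close> leaves only the negative part of \<open>h\<close>: with \<open>w\<close> a root of
  \<open>m\<close>, the element \<open>star (x n) * (x n)\<close> equals \<open>- (w n)\<^sup>2\<close>. Hence \<open>x n = 0\<close>, the negative part vanishes, and
  \<open>h\<close> is its own modulus.
\<close>
lemma positive_star_mult_self: "positive (star x * x)"
proof -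
  define h where "h = star x * x"
  have sa: "star h = h" by (simp add: h_def star_mult star_star)
  obtain m where m: "positive m" "m * m = h * h"
    and comm_m: "\<And>y. y * (h * h) = (h * h) * y \<Longrightarrow> y * m = m * y"
    by (rule positive_sqrt[OF positive_square[OF sa]]) blast
  have hm: "h * m = m * h" by (rule comm_m) (simp add: mult.assoc)
  obtain w where w: "positive w" "w * w = m"
    and comm_w: "\<And>y. y * m = m * y \<Longrightarrow> y * w = w * y"
    by (rule positive_sqrt[OF m(1)]) blast
  have hw: "h * w = w * h" by (rule comm_w) (rule hm)
  have mw: "m * w = w * m" by (rule comm_w) simp
  define n where "n = m - h"
  have sa_n: "star n = n" by (simp add: n_def star_diff positive_selfadjoint m sa)
  have hn: "h * n = - (m * n)"
    by (simp add: n_def algebra_simps m hm)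
  have wn: "w * n = n * w" by (simp add: n_def algebra_simps mw hw)
  have "star (x * n) * (x * n) = n * (h * n)"
    by (simp add: star_mult sa_n h_def mult.assoc)
  also have "\<dots> = - ((w * n) * (w * n))"
    by (simp add: hn flip: w(2)) (metis mult.assoc wn)
  finally have "x * n = 0"
    using sa_n by (intro star_mult_self_eq_minus_square[of "w * n"])
      (simp_all add: star_mult positive_selfadjoint w flip: wn)
  then have "h * n = 0" by (simp add: h_def mult.assoc)
  moreover from this have "m * n = 0" using hn by simp
  ultimately have "star n * n = 0" by (simp add: sa_n) (simp add: n_def left_diff_distrib)
  then have "n = 0" by (simp add: star_mult_self_eq_0)
  then show ?thesis using m(1) by (simp add: n_def h_def)
qed

section \<open>Monotonicity of the norm on sums of squares\<close>

lemma positive_sum: "(\<And>i. i \<in> I \<Longrightarrow> positive (f i)) \<Longrightarrow> positive (sum f I)"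
  by (induction I rule: infinite_finite_induct) (auto simp: positive_zero positive_add)

text \<open>
  Positivity is a notion of the unital algebra of adjointable operators, so the comparison is made
  there and pulled back along the isometric embedding.
\<close>
lemma norm_sum_star_mult_mono:
  fixes x :: "'i \<Rightarrow> 'a::cstar_algebra"
  assumes "finite G" "F \<subseteq> G"
  shows "norm (\<Sum>i\<in>F. star (x i) * x i) \<le> norm (\<Sum>i\<in>G. star (x i) * x i)"
proof -
  let ?S = "\<lambda>I. \<Sum>i\<in>I. star (x i) * x i"
  have eq: "left_mult (?S I) = (\<Sum>i\<in>I. star (left_mult (x i)) * left_mult (x i))" for I
    by (simp add: left_mult_sum left_mult_mult left_mult_star)
  have pos: "positive (left_mult (?S I))" for I
    unfolding eq by (intro positive_sum positive_star_mult_self)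
  have "?S G = ?S F + ?S (G - F)"
    using sum.subset_diff[OF assms(2,1), of "\<lambda>i. star (x i) * x i"] by (simp add: add.commute)
  then have "norm (left_mult (?S F)) \<le> norm (left_mult (?S G))"
    using norm_le_norm_add_positive[OF pos pos, of F "G - F"] by (simp add: left_mult_add)
  then show ?thesis by (simp add: norm_left_mult)
qed

lemma norm_sum_star_mult_le_suminf:
  fixes x :: "nat \<Rightarrow> 'a::cstar_algebra"
  assumes "summable (\<lambda>i. star (x i) * x i)" "finite F"
  shows "norm (\<Sum>i\<in>F. star (x i) * x i) \<le> norm (\<Sum>i. star (x i) * x i)"
proof (rule LIMSEQ_le_const)
  show "(\<lambda>n. norm (\<Sum>i<n. star (x i) * x i)) \<longlonglongrightarrow> norm (\<Sum>i. star (x i) * x i)"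
    using assms by (intro tendsto_norm summable_LIMSEQ)
  obtain N where "F \<subseteq> {..<N}"
    using finite_nat_iff_bounded assms(2) by blast
  then show "\<exists>N. \<forall>n\<ge>N. norm (\<Sum>i\<in>F. star (x i) * x i) \<le> norm (\<Sum>i<n. star (x i) * x i)"
    by (intro exI[of _ N] allI impI norm_sum_star_mult_mono) auto
qed

section \<open>Quasi-multipliers of the standard module\<close>

lemma QM_bound_nonneg:
  assumes "q \<in> QM U"
  obtains K where "K \<ge> 0" "\<And>a b. bnorm U (q a b) \<le> K * norm a * norm b"
proof -
  obtain K where K: "\<And>a b. bnorm U (q a b) \<le> K * norm a * norm b"
    using assms by (auto simp: QM_def)
  have "bnorm U (q a b) \<le> \<bar>K\<bar> * norm a * norm b" for a b
    using order.trans[OF K, of a b "\<bar>K\<bar> * norm a * norm b"] by (simp add: mult_right_mono)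
  then show ?thesis using that[of "\<bar>K\<bar>"] by simp
qed

lemma QM_I:
  assumes "\<And>a b. q a b \<in> elems U"
    and "\<And>a a' b. q (a + a') b = add U (q a b) (q a' b)"
    and "\<And>a b b'. q a (b + b') = add U (q a b) (q a b')"
    and "\<And>z a b. q (scaleC z a) b = bimodule.scale U z (q a b)"
    and "\<And>z a b. q a (scaleC z b) = bimodule.scale U z (q a b)"
    and "\<And>a b. bnorm U (q a b) \<le> K * norm a * norm b"
    and "\<And>a b c d. q (c * a) (b * d) = rmul U (lmul U c (q a b)) d"
  shows "q \<in> QM U"
  unfolding QM_def mem_Collect_eq using assms by (intro conjI allI exI[of _ K])

lemma bimodule_simps:
  "elems alg_bimodule = UNIV" "add alg_bimodule = (+)" "bimodule.scale alg_bimodule = scaleC"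
  "lmul alg_bimodule = (*)" "rmul alg_bimodule = (*)" "bnorm alg_bimodule = norm"
  "elems l2_bimodule = {x. summable (\<lambda>i. star (x i) * x i)}"
  "add l2_bimodule = (\<lambda>x y i. x i + y i)" "bimodule.scale l2_bimodule = (\<lambda>z x i. scaleC z (x i))"
  "lmul l2_bimodule = (\<lambda>a x i. a * x i)" "rmul l2_bimodule = (\<lambda>x a i. x i * a)"
  "bnorm l2_bimodule = (\<lambda>x. sqrt (norm (\<Sum>i. star (x i) * x i)))"
  "bnorm (pow_bimodule n) = (\<lambda>x. sqrt (norm (\<Sum>i<n. star (x i) * x i)))"
  by (simp_all add: alg_bimodule_def l2_bimodule_def pow_bimodule_def)

lemma bnorm_qm_dsum:
  "bnorm (pow_bimodule n) (qm_dsum n q a c) = sqrt (norm (\<Sum>i<n. star (q i a c) * q i a c))"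
  by (simp add: bimodule_simps qm_dsum_def)

text \<open>
  Boundedness of a component is the case of a single summand in the comparison of a partial sum with
  the whole series.
\<close>
lemma component_QM:
  assumes r: "r \<in> QM l2_bimodule"
  shows "(\<lambda>a c. r a c i) \<in> QM alg_bimodule"
proof -
  obtain K where K: "\<And>a b. bnorm l2_bimodule (r a b) \<le> K * norm a * norm b"
    using QM_bound_nonneg[OF r] by blast
  have "norm (r a b i) \<le> K * norm a * norm b" for a b
  proof -
    have "summable (\<lambda>j. star (r a b j) * r a b j)"
      using r by (auto simp: QM_def bimodule_simps)
    from norm_sum_star_mult_le_suminf[OF this, of "{i}"]
    have "(norm (r a b i))\<^sup>2 \<le> norm (\<Sum>j. star (r a b j) * r a b j)"
      by (simp add: cstar_identity)
    then have "norm (r a b i) \<le> bnorm l2_bimodule (r a b)"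
      by (simp add: bimodule_simps real_le_rsqrt)
    then show ?thesis using K order.trans by blast
  qed
  moreover have "r (a + a') b = (\<lambda>i. r a b i + r a' b i)" "r a (b + b') = (\<lambda>i. r a b i + r a b' i)"
    "r (scaleC z a) b = (\<lambda>i. scaleC z (r a b i))" "r a (scaleC z b) = (\<lambda>i. scaleC z (r a b i))"
    "r (c * a) (b * d) = (\<lambda>i. c * r a b i * d)" for a a' b b' c d z
    using r by (simp_all add: QM_def bimodule_simps)
  ultimately show ?thesis
    by (intro QM_I[where K = K]) (simp_all only: bimodule_simps UNIV_I)
qed

lemma qm_norm_dsum_components_le:
  assumes r: "r \<in> QM l2_bimodule"
  shows "\<exists>K. \<forall>n. qm_norm (pow_bimodule n) (qm_dsum n (\<lambda>i a c. r a c i)) \<le> K"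
proof -
  obtain K where K0: "K \<ge> 0" and K: "\<And>a b. bnorm l2_bimodule (r a b) \<le> K * norm a * norm b"
    using QM_bound_nonneg[OF r] by blast
  have "qm_norm (pow_bimodule n) (qm_dsum n (\<lambda>i a c. r a c i)) \<le> K" for n
    unfolding qm_norm_def
  proof (rule cSup_least)
    have "norm (0::'a) \<le> 1" by simp
    then show "{bnorm (pow_bimodule n) (qm_dsum n (\<lambda>i a c. r a c i) a b) |a b. norm a \<le> 1 \<and> norm b \<le> 1} \<noteq> {}"
      by blast
  next
    fix s
    assume "s \<in> {bnorm (pow_bimodule n) (qm_dsum n (\<lambda>i a c. r a c i) a b) |a b. norm a \<le> 1 \<and> norm b \<le> 1}"
    then obtain a b where s: "s = bnorm (pow_bimodule n) (qm_dsum n (\<lambda>i a c. r a c i) a b)"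
      and ab: "norm a \<le> 1" "norm b \<le> 1" by blast
    have "summable (\<lambda>j. star (r a b j) * r a b j)"
      using r by (auto simp: QM_def bimodule_simps)
    from norm_sum_star_mult_le_suminf[OF this, of "{..<n}"]
    have "s \<le> bnorm l2_bimodule (r a b)"
      by (simp add: s bnorm_qm_dsum) (simp add: bimodule_simps)
    also have "\<dots> \<le> K * norm a * norm b" by (rule K)
    also have "\<dots> \<le> K"
      using mult_mono[OF mult_left_mono[OF ab(1) K0] ab(2)] K0 by simp
    finally show "s \<le> K" .
  qed
  then show ?thesis by blast
qed

text \<open>
  A supremum of an unbounded set of reals carries no information, so a bound on \<^const>\<open>qm_norm\<close> is usable
  only once the set of values is known to be bounded. A finite direct sum inherits some
  bound, depending on \<open>n\<close>, from its components.
\<close>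
lemma bdd_above_dsum:
  assumes "\<And>i. q i \<in> QM alg_bimodule"
  shows "bdd_above {bnorm (pow_bimodule n) (qm_dsum n q a b) |a b. norm a \<le> 1 \<and> norm b \<le> 1}"
proof -
  have "\<exists>K\<ge>0. \<forall>a b. norm (q i a b) \<le> K * norm a * norm b" for i
    by (rule QM_bound_nonneg[OF assms[of i]]) (auto simp: bimodule_simps)
  then obtain K where K0: "K i \<ge> 0" and K: "norm (q i a b) \<le> K i * norm a * norm b" for i a b
    by metis
  have "bnorm (pow_bimodule n) (qm_dsum n q a b) \<le> sqrt (\<Sum>i<n. (K i)\<^sup>2)"
    if ab: "norm a \<le> 1" "norm b \<le> 1" for a b
  proof -
    have "norm (q i a b) \<le> K i" for i
    proof -
      have "norm (q i a b) \<le> K i * norm a * norm b" by (rule K)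
      also have "\<dots> \<le> K i"
        using mult_mono[OF mult_left_mono[OF ab(1) K0] ab(2)] K0 by simp
      finally show ?thesis .
    qed
    then have "norm (\<Sum>i<n. star (q i a b) * q i a b) \<le> (\<Sum>i<n. (K i)\<^sup>2)"
      by (intro sum_norm_le) (simp only: cstar_identity power_mono norm_ge_zero)
    then show ?thesis unfolding bnorm_qm_dsum by (rule real_sqrt_le_mono)
  qed
  then show ?thesis by (intro bdd_aboveI) blast
qed

text \<open>
  The passage from the unit ball to arbitrary arguments, by homogeneity.
\<close>
lemma sum_bound_of_qm_norm:
  assumes q: "\<And>i. q i \<in> QM alg_bimodule"
    and K: "qm_norm (pow_bimodule n) (qm_dsum n q) \<le> K"
  shows "sqrt (norm (\<Sum>i<n. star (q i a b) * q i a b)) \<le> K * norm a * norm b"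
proof (cases "a = 0 \<or> b = 0")
  case True
  have "norm (q i a b) \<le> 0" for i
  proof -
    obtain L where "\<And>a b. norm (q i a b) \<le> L * norm a * norm b"
      by (rule QM_bound_nonneg[OF q[of i]]) (auto simp: bimodule_simps)
    from this[of a b] show ?thesis using True by (elim disjE) simp_all
  qed
  then show ?thesis using True by auto
next
  case False
  define r s where "r = norm a" and "s = norm b"
  have rs: "r > 0" "s > 0" using False by (simp_all add: r_def s_def)
  define a' b' where "a' = inverse r *\<^sub>R a" and "b' = inverse s *\<^sub>R b"
  have unit: "norm a' \<le> 1" "norm b' \<le> 1"
    using rs by (simp_all add: a'_def b'_def) (simp_all add: r_def s_def)
  have hom: "q i (scaleC z u) v = scaleC z (q i u v)" "q i u (scaleC z v) = scaleC z (q i u v)" for i z u v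
    using q[of i] by (auto simp: QM_def bimodule_simps)
  have ab: "a = r *\<^sub>R a'" "b = s *\<^sub>R b'" using rs by (simp_all add: a'_def b'_def)
  have "q i a b = (r * s) *\<^sub>R q i a' b'" for i
    by (simp add: ab scaleR_scaleC hom scaleC_scaleC mult.commute)
  then have "(\<Sum>i<n. star (q i a b) * q i a b) = (r * s)\<^sup>2 *\<^sub>R (\<Sum>i<n. star (q i a' b') * q i a' b')"
    by (simp add: star_scaleR scaleR_sum_right power2_eq_square)
  then have "sqrt (norm (\<Sum>i<n. star (q i a b) * q i a b))
      = r * s * bnorm (pow_bimodule n) (qm_dsum n q a' b')"
    using rs by (simp add: bnorm_qm_dsum real_sqrt_mult)
  also have "bnorm (pow_bimodule n) (qm_dsum n q a' b') \<le> qm_norm (pow_bimodule n) (qm_dsum n q)"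
    unfolding qm_norm_def by (rule cSup_upper[OF _ bdd_above_dsum[OF q]]) (use unit in blast)
  also have "\<dots> \<le> K" by (rule K)
  finally show ?thesis using rs by (simp add: r_def s_def mult_ac)
qed

text \<open>
  The uniform bound on partial sums survives in the limit.
\<close>
lemma qm_of_seq_QM:
  assumes q: "\<And>i. q i \<in> QM alg_bimodule"
    and K: "\<And>n. qm_norm (pow_bimodule n) (qm_dsum n q) \<le> K"
    and summable: "\<And>a c. summable (\<lambda>i. star (q i a c) * q i a c)"
  shows "qm_of_seq q \<in> QM l2_bimodule"
proof -
  have "sqrt (norm (\<Sum>i. star (q i a b) * q i a b)) \<le> K * norm a * norm b" for a b
  proof (rule LIMSEQ_le_const2)
    show "(\<lambda>n. sqrt (norm (\<Sum>i<n. star (q i a b) * q i a b)))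
        \<longlonglongrightarrow> sqrt (norm (\<Sum>i. star (q i a b) * q i a b))"
      by (intro tendsto_intros summable_LIMSEQ summable)
    show "\<exists>N. \<forall>n\<ge>N. sqrt (norm (\<Sum>i<n. star (q i a b) * q i a b)) \<le> K * norm a * norm b"
      using sum_bound_of_qm_norm[OF q K] by blast
  qed
  moreover have "q i (a + a') b = q i a b + q i a' b" "q i a (b + b') = q i a b + q i a b'"
    "q i (scaleC z a) b = scaleC z (q i a b)" "q i a (scaleC z b) = scaleC z (q i a b)"
    "q i (c * a) (b * d) = c * q i a b * d" for i a a' b b' c d z
    using q[of i] by (simp_all add: QM_def bimodule_simps)
  ultimately show ?thesis
    by (intro QM_I[where K = K])
       (simp_all only: bimodule_simps qm_of_seq_def mem_Collect_eq summable)
qed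

theorem corollary4p2:
  "bij_betw qm_of_seq
     {q :: nat \<Rightarrow> 'a \<Rightarrow> 'a \<Rightarrow> 'a::cstar_algebra.
        (\<forall>i. q i \<in> QM alg_bimodule) \<and>
        (\<exists>K. \<forall>n. qm_norm (pow_bimodule n) (qm_dsum n q) \<le> K) \<and>
        (\<forall>a c. summable (\<lambda>i. star (q i a c) * q i a c))}
     (QM l2_bimodule)"
proof (rule bij_betw_byWitness[where f' = "\<lambda>r i a c. r a c i"])
  show "qm_of_seq ` {q. (\<forall>i. q i \<in> QM alg_bimodule) \<and>
      (\<exists>K. \<forall>n. qm_norm (pow_bimodule n) (qm_dsum n q) \<le> K) \<and>
      (\<forall>a c. summable (\<lambda>i. star (q i a c) * q i a c))} \<subseteq> (QM l2_bimodule :: ('a \<Rightarrow> 'a \<Rightarrow> nat \<Rightarrow> 'a) set)"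
  proof (rule image_subsetI)
    fix q :: "nat \<Rightarrow> 'a \<Rightarrow> 'a \<Rightarrow> 'a"
    assume "q \<in> {q. (\<forall>i. q i \<in> QM alg_bimodule) \<and>
      (\<exists>K. \<forall>n. qm_norm (pow_bimodule n) (qm_dsum n q) \<le> K) \<and>
      (\<forall>a c. summable (\<lambda>i. star (q i a c) * q i a c))}"
    then obtain K where "\<forall>i. q i \<in> QM alg_bimodule"
      "\<forall>n. qm_norm (pow_bimodule n) (qm_dsum n q) \<le> K"
      "\<forall>a c. summable (\<lambda>i. star (q i a c) * q i a c)"
      by (elim CollectE conjE exE)
    then show "qm_of_seq q \<in> QM l2_bimodule"
      by (intro qm_of_seq_QM[where K = K]) simp_all
  qed
  show "(\<lambda>r i a c. r a c i) ` QM l2_bimodule \<subseteq> {q :: nat \<Rightarrow> 'a \<Rightarrow> 'a \<Rightarrow> 'a. (\<forall>i. q i \<in> QM alg_bimodule) \<and>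
      (\<exists>K. \<forall>n. qm_norm (pow_bimodule n) (qm_dsum n q) \<le> K) \<and>
      (\<forall>a c. summable (\<lambda>i. star (q i a c) * q i a c))}"
  proof (rule image_subsetI)
    fix r :: "'a \<Rightarrow> 'a \<Rightarrow> nat \<Rightarrow> 'a"
    assume r: "r \<in> QM l2_bimodule"
    then have "summable (\<lambda>i. star (r a c i) * r a c i)" for a c
      by (auto simp: QM_def bimodule_simps)
    then show "(\<lambda>i a c. r a c i) \<in> {q. (\<forall>i. q i \<in> QM alg_bimodule) \<and>
        (\<exists>K. \<forall>n. qm_norm (pow_bimodule n) (qm_dsum n q) \<le> K) \<and>
        (\<forall>a c. summable (\<lambda>i. star (q i a c) * q i a c))}"
      using component_QM[OF r] qm_norm_dsum_components_le[OF r]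
      by (intro CollectI conjI allI) simp_all
  qed
qed (simp_all add: qm_of_seq_def fun_eq_iff)

end
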